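(* Assume that with probability 1, for every $n$, $g_n$ is continuously differentiable on $\Theta$ and $h_n$ is convex and proper. Let $\hat\theta=\hat\theta_n\in\operatorname{argmin}_{\theta\in\Theta}\{g_n(\theta)+h_n(\theta)\}$, which is assumed to exist almost surely. Assume there is a (nonrandom) positive definite matrix $H\in\mathbb{R}^{d\times d}$ such that: (i) for each $M>0$, $$\sup_{\theta\in\Theta:\ \sqrt n\|\theta-\hat\theta\|<M}\Big\|\sqrt n\big(\nabla g_n(\theta)-\nabla g_n(\hat\theta)\big)-\sqrt n\,H(\theta-\hat\theta)\Big\|\to 0\quad\text{in probability};$$ (ii) $C_n\succ 0$ and $C_n^{-1}H\to I$ in probability, where $I$ is the $d\times d$ identity matrix. Then for any $\sqrt n$-consistent estimator $\hat\theta_{init}$ of $\hat\theta$, the estimator $\hat\theta$ and the one-step estimator $$\hat\theta_{ose}=\operatorname{prox}_{h_n}^{C_n}\big(\hat\theta_{init}-C_n^{-1}\nabla g_n(\hat\theta_{init})\big)$$ (assumed to exist almost surely) are asymptotically equivalent.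
   Context: $\Theta\subseteq\mathbb{R}^d$ is open. On a probability space $(\Omega,\mathcal A,P)$ there are sequences of random functions $g_n:\Omega\times\Theta\to\mathbb{R}$ and $h_n:\Omega\times\Theta\to\mathbb{R}\cup\{\infty\}$, and a sequence $C_n$ of random $d\times d$ matrices; dependence on $\Omega$ is suppressed, and gradients are with respect to $\theta$. The function $h_n$ is regarded as a function on $\mathbb{R}^d$ by setting it to $+\infty$ outside $\Theta$. Estimators are random vectors with values in $\Theta$, depending on $n$. For $f:\mathbb{R}^d\to\mathbb{R}\cup\{\infty\}$ and a (symmetric) positive definite matrix $C$, the scaled proximal operator is $$\operatorname{prox}_f^C(x)=\operatorname{argmin}_{w\in\mathbb{R}^d}\Big\{f(w)+\tfrac12\|w-x\|_C^2\Big\},\qquad \|x\|_C^2=\langle x,Cx\rangle .$$ $\hat\theta_{init}$ is $\sqrt n$-consistent for $\hat\theta$ if $\sqrt n(\hat\theta_{init}-\hat\theta)=O_P(1)$ (bounded in probability). Two estimators $\hat\theta,\tilde\theta$ are asymptotically equivalent if $\sqrt n\|\hat\theta-\tilde\theta\|=o_P(1)$ (converges to $0$ in probability). *)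

theory Defs
  imports "HOL-Probability.Probability"
begin

text \<open>Meaningful only where a gradient exists; it is then unique.\<close>

definition gradient :: "('a::euclidean_space \<Rightarrow> real) \<Rightarrow> 'a \<Rightarrow> 'a" where
  "gradient f x = (THE D. GDERIV f x :> D)"

definition continuously_differentiable_on ::
  "('a::euclidean_space \<Rightarrow> real) \<Rightarrow> 'a set \<Rightarrow> bool" where
  "continuously_differentiable_on f S \<longleftrightarrow>
     (\<forall>x\<in>S. \<exists>D. GDERIV f x :> D) \<and> continuous_on S (gradient f)"

definition extend_infty :: "'a set \<Rightarrow> ('a \<Rightarrow> ereal) \<Rightarrow> 'a \<Rightarrow> ereal" where
  "extend_infty S f x = (if x \<in> S then f x else \<infinity>)"

text \<open>The inequality is used only for functions that do not take the value \<open>-\<infinity>\<close>,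
  so no sum \<open>\<infinity> + (-\<infinity>)\<close> occurs.\<close>

definition convex_ereal :: "('a::real_vector \<Rightarrow> ereal) \<Rightarrow> bool" where
  "convex_ereal f \<longleftrightarrow>
     (\<forall>x y. \<forall>t::real. 0 < t \<longrightarrow> t < 1 \<longrightarrow>
        f ((1 - t) *\<^sub>R x + t *\<^sub>R y) \<le> ereal (1 - t) * f x + ereal t * f y)"

definition proper_ereal :: "('a \<Rightarrow> ereal) \<Rightarrow> bool" where
  "proper_ereal f \<longleftrightarrow> (\<forall>x. f x \<noteq> -\<infinity>) \<and> (\<exists>x. f x \<noteq> \<infinity>)"

definition pos_def :: "real^'d^'d \<Rightarrow> bool" where
  "pos_def A \<longleftrightarrow> transpose A = A \<and> (\<forall>x. x \<noteq> 0 \<longrightarrow> 0 < x \<bullet> (A *v x))"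

definition scaled_norm_sq :: "real^'d^'d \<Rightarrow> real^'d \<Rightarrow> real" where
  "scaled_norm_sq C x = x \<bullet> (C *v x)"

text \<open>The argmin is kept as the set of all minimizers. For \<open>C\<close> positive definite and
  \<open>f\<close> convex and proper it has at most one element, so that \<open>w \<in> prox C f x\<close> says that the
  proximal point exists and equals \<open>w\<close>.\<close>

definition prox :: "real^'d^'d \<Rightarrow> (real^'d \<Rightarrow> ereal) \<Rightarrow> real^'d \<Rightarrow> (real^'d) set" where
  "prox C f x =
     {w. is_arg_min (\<lambda>w. f w + ereal (1/2 * scaled_norm_sq C (w - x))) (\<lambda>_. True) w}"

text \<open>Probabilities of events such as \<open>{Z n > \<epsilon>}\<close> are taken in the sense of outer probability,
  since a supremum over an uncountable set need not be measurable; on measurable events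
  this is the ordinary probability. Values in ennreal allow for infinite suprema.\<close>

definition vanishes_in_prob :: "'w measure \<Rightarrow> (nat \<Rightarrow> 'w \<Rightarrow> ennreal) \<Rightarrow> bool" where
  "vanishes_in_prob M Z \<longleftrightarrow>
     (\<forall>\<epsilon>::real. \<epsilon> > 0 \<longrightarrow>
        (\<lambda>n. outer_measure_of M {\<omega> \<in> space M. Z n \<omega> > ennreal \<epsilon>}) \<longlonglongrightarrow> 0)"

definition tendsto_in_prob ::
  "'w measure \<Rightarrow> (nat \<Rightarrow> 'w \<Rightarrow> 'b::metric_space) \<Rightarrow> 'b \<Rightarrow> bool" where
  "tendsto_in_prob M X l \<longleftrightarrow> vanishes_in_prob M (\<lambda>n \<omega>. ennreal (dist (X n \<omega>) l))"

definition bounded_in_prob ::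
  "'w measure \<Rightarrow> (nat \<Rightarrow> 'w \<Rightarrow> 'b::real_normed_vector) \<Rightarrow> bool" where
  "bounded_in_prob M X \<longleftrightarrow>
     (\<forall>\<epsilon>::real. \<epsilon> > 0 \<longrightarrow>
        (\<exists>K::real. \<forall>n. outer_measure_of M {\<omega> \<in> space M. norm (X n \<omega>) > K} \<le> ennreal \<epsilon>))"

text \<open>Membership in \<open>\<Theta>\<close> is required only almost surely, because estimators
  defined as minimizers are assumed to exist only almost surely.\<close>

definition estimator :: "'w measure \<Rightarrow> (real^'d) set \<Rightarrow> (nat \<Rightarrow> 'w \<Rightarrow> real^'d) \<Rightarrow> bool" where
  "estimator M \<Theta> T \<longleftrightarrow>
     (\<forall>n. T n \<in> borel_measurable M \<and> (AE \<omega> in M. T n \<omega> \<in> \<Theta>))"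

definition sqrt_n_consistent ::
  "'w measure \<Rightarrow> (nat \<Rightarrow> 'w \<Rightarrow> real^'d) \<Rightarrow> (nat \<Rightarrow> 'w \<Rightarrow> real^'d) \<Rightarrow> bool" where
  "sqrt_n_consistent M T S \<longleftrightarrow>
     bounded_in_prob M (\<lambda>n \<omega>. sqrt (real n) *\<^sub>R (T n \<omega> - S n \<omega>))"

definition asymptotically_equivalent ::
  "'w measure \<Rightarrow> (nat \<Rightarrow> 'w \<Rightarrow> real^'d) \<Rightarrow> (nat \<Rightarrow> 'w \<Rightarrow> real^'d) \<Rightarrow> bool" where
  "asymptotically_equivalent M T S \<longleftrightarrow>
     tendsto_in_prob M (\<lambda>n \<omega>. sqrt (real n) * norm (T n \<omega> - S n \<omega>)) 0"

end

theory Submission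
  imports Defs
begin

text \<open>
  Write \<open>a\<close> for the minimizer of \<open>g + h\<close>, \<open>b\<close> for the initial estimator and \<open>c\<close> for the
  one-step estimator. Both \<open>a\<close> and \<open>c\<close> minimize a smooth function plus the same convex
  function \<open>h\<close>, so each satisfies a variational inequality
  (\<open>first_order_optimality\<close>). Testing each inequality at the other point and adding cancels
  \<open>h\<close> altogether, however irregular it is, and leaves
  \<open>(c - a) \<bullet> C (c - a) \<le> (c - a) \<bullet> ((C - H) (b - a) - r)\<close>, where
  \<open>r = \<nabla>g b - \<nabla>g a - H (b - a)\<close>.
  For \<open>C\<close> close to the positive definite \<open>H\<close> the left side dominates a fixed multiple of the square of
  \<open>norm (c - a)\<close>, and Cauchy-Schwarz on the right bounds \<open>norm (c - a)\<close> by a constant times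
  \<open>norm (C - H) * norm (b - a) + norm r\<close> (\<open>one_step_error\<close>). That \<open>C\<close> is close to \<open>H\<close> in
  the additive sense follows from \<open>C\<^sup>-\<^sup>1H\<close> being close to the identity
  (\<open>norm_diff_le_preconditioner_error\<close>).

  Multiplied by the square root of \<open>n\<close>, the first term is a vanishing factor times a sequence bounded
  in probability, and the second vanishes by the uniform linearization of the gradient
  near \<open>a\<close>, where \<open>b\<close> lies with probability as close to one as desired.
  The passage from this bound, valid for almost every outcome, to probabilities is
  \<open>vanishes_in_prob_if_small_on_bounded\<close>, which rests on the subadditivity of outer measure.
\<close>

section \<open>Outer probability\<close>

text \<open>The measurable covers of \<open>A\<close> and \<open>B\<close> that attain the two outer measures together cover the union.\<close>

lemma outer_measure_of_Un:
  "outer_measure_of M (A \<union> B) \<le> outer_measure_of M A + outer_measure_of M B"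
proof (cases "A \<subseteq> space M \<and> B \<subseteq> space M")
  case True
  obtain A' where A': "A' \<in> sets M" "A \<subseteq> A'" "outer_measure_of M A = emeasure M A'"
    using outer_measure_of_attain[of A M] True by blast
  obtain B' where B': "B' \<in> sets M" "B \<subseteq> B'" "outer_measure_of M B = emeasure M B'"
    using outer_measure_of_attain[of B M] True by blast
  have "outer_measure_of M (A \<union> B) \<le> outer_measure_of M (A' \<union> B')"
    using A' B' by (intro outer_measure_of_mono) auto
  also have "\<dots> = emeasure M (A' \<union> B')"
    using A' B' by simp
  also have "\<dots> \<le> outer_measure_of M A + outer_measure_of M B"
    using A' B' by (simp add: emeasure_subadditive)
  finally show ?thesis .
next
  case False
  (* A set that leaves the space has no measurable cover: its outer measure is an empty infimum. *)
  have top: "outer_measure_of M D = \<top>" if "\<not> D \<subseteq> space M" for D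
  proof -
    have "{B \<in> sets M. D \<subseteq> B} = {}"
      using that sets.sets_into_space by blast
    then show ?thesis
      by (simp only: outer_measure_of_def) simp
  qed
  show ?thesis
    using False top by (metis add_top_left_ennreal add_top_right_ennreal le_iff_add top_greatest)
qed

lemma outer_measure_of_le_AE:
  assumes "AE \<omega> in M. \<omega> \<in> A \<longrightarrow> \<omega> \<in> B" "A \<subseteq> space M"
  shows "outer_measure_of M A \<le> outer_measure_of M B"
proof -
  obtain N where N: "N \<in> null_sets M" "{\<omega> \<in> space M. \<not> (\<omega> \<in> A \<longrightarrow> \<omega> \<in> B)} \<subseteq> N"
    using assms(1) unfolding eventually_ae_filter by blast
  have "outer_measure_of M A \<le> outer_measure_of M (B \<union> N)"
    using N(2) assms(2) by (intro outer_measure_of_mono) blast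
  also have "\<dots> \<le> outer_measure_of M B + outer_measure_of M N"
    by (rule outer_measure_of_Un)
  also have "outer_measure_of M N = 0"
    using N(1) by (simp add: null_sets_def)
  finally show ?thesis by simp
qed

text \<open>
  This captures the principle that a bounded sequence times a vanishing one
  vanishes. The sequence \<open>Y K\<close> may depend on the bound \<open>K\<close> for \<open>X\<close>: the typical \<open>Y K\<close> is
  a supremum over a neighbourhood of radius \<open>K\<close>. Outside an event of small probability, uniformly in the
  index, \<open>X\<close> is below some fixed \<open>K\<close>; once \<open>K\<close> is fixed, \<open>Y K\<close> and \<open>E\<close> exceed the
  tolerance \<open>\<rho>\<close> only on events whose outer probability tends to zero.
\<close>

lemma vanishes_in_prob_if_small_on_bounded:
  fixes X :: "nat \<Rightarrow> 'w \<Rightarrow> 'b::real_normed_vector"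
  assumes X: "bounded_in_prob M X"
    and Y: "\<And>K::real. K > 0 \<Longrightarrow> vanishes_in_prob M (Y K)"
    and E: "vanishes_in_prob M E"
    and Z: "\<And>(K::real) (\<epsilon>::real). K > 0 \<Longrightarrow> \<epsilon> > 0 \<Longrightarrow> \<exists>\<rho>>0. AE \<omega> in M. \<forall>n.
              norm (X n \<omega>) < K \<longrightarrow> Y K n \<omega> \<le> ennreal \<rho> \<longrightarrow> E n \<omega> \<le> ennreal \<rho> \<longrightarrow>
              Z n \<omega> \<le> ennreal \<epsilon>"
  shows "vanishes_in_prob M Z"
  unfolding vanishes_in_prob_def
proof (intro allI impI order_tendstoI)
  fix \<epsilon> :: real and \<delta> :: ennreal
  assume "\<epsilon> > 0" and "0 < \<delta>"
  obtain \<eta> :: real where \<eta>: "\<eta> > 0" "ennreal (3 * \<eta>) < \<delta>"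
  proof -
    obtain \<eta>' where \<eta>': "0 < \<eta>'" "\<eta>' < \<delta>"
      using dense[OF \<open>0 < \<delta>\<close>] by blast
    then obtain r where "\<eta>' = ennreal r" "0 \<le> r"
      by (cases \<eta>') auto
    with \<eta>' show thesis
      by (intro that[of "r / 3"]) auto
  qed
  obtain K0 where K0: "\<And>n. outer_measure_of M {\<omega> \<in> space M. norm (X n \<omega>) > K0} \<le> ennreal \<eta>"
    using X \<eta>(1) unfolding bounded_in_prob_def by blast
  (* X is controlled by a weak inequality and a K0 of any sign; the hypotheses need norm (X n \<omega>) < K with K > 0. *)
  define K where "K = max K0 0 + 1"
  have "K > 0" by (simp add: K_def)
  from Z[OF this \<open>\<epsilon> > 0\<close>] obtain \<rho> where \<rho>: "\<rho> > 0"
    and Z': "AE \<omega> in M. \<forall>n. norm (X n \<omega>) < K \<longrightarrow> Y K n \<omega> \<le> ennreal \<rho> \<longrightarrow> E n \<omega> \<le> ennreal \<rho> \<longrightarrow>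
              Z n \<omega> \<le> ennreal \<epsilon>"
    by blast
  let ?X = "\<lambda>n. {\<omega> \<in> space M. norm (X n \<omega>) > K0}"
  let ?Y = "\<lambda>n. {\<omega> \<in> space M. Y K n \<omega> > ennreal \<rho>}"
  let ?E = "\<lambda>n. {\<omega> \<in> space M. E n \<omega> > ennreal \<rho>}"
  let ?Z = "\<lambda>n. {\<omega> \<in> space M. Z n \<omega> > ennreal \<epsilon>}"
  have le: "outer_measure_of M (?Z n)
      \<le> outer_measure_of M (?X n) + (outer_measure_of M (?Y n) + outer_measure_of M (?E n))" for n
  proof -
    have "AE \<omega> in M. \<omega> \<in> ?Z n \<longrightarrow> \<omega> \<in> ?X n \<union> (?Y n \<union> ?E n)"
      using Z'
    proof (eventually_elim)
      case (elim \<omega>)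
      have "norm (X n \<omega>) \<le> K0 \<Longrightarrow> norm (X n \<omega>) < K"
        by (simp add: K_def)
      then show ?case
        using elim by (auto simp: not_less[symmetric])
    qed
    then have "outer_measure_of M (?Z n) \<le> outer_measure_of M (?X n \<union> (?Y n \<union> ?E n))"
      by (rule outer_measure_of_le_AE) auto
    also have "\<dots> \<le> outer_measure_of M (?X n) + outer_measure_of M (?Y n \<union> ?E n)"
      by (rule outer_measure_of_Un)
    also have "\<dots> \<le> outer_measure_of M (?X n) + (outer_measure_of M (?Y n) + outer_measure_of M (?E n))"
      by (intro add_left_mono outer_measure_of_Un)
    finally show ?thesis .
  qed
  have "eventually (\<lambda>n. outer_measure_of M (?Y n) < ennreal \<eta>) sequentially"
    using Y[OF \<open>K > 0\<close>] \<rho> \<eta>(1) unfolding vanishes_in_prob_def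
    by (auto intro: order_tendstoD)
  moreover have "eventually (\<lambda>n. outer_measure_of M (?E n) < ennreal \<eta>) sequentially"
    using E \<rho> \<eta>(1) unfolding vanishes_in_prob_def
    by (auto intro: order_tendstoD)
  ultimately show "eventually (\<lambda>n. outer_measure_of M (?Z n) < \<delta>) sequentially"
  proof (eventually_elim)
    case (elim n)
    have "outer_measure_of M (?Z n) \<le> ennreal \<eta> + (ennreal \<eta> + ennreal \<eta>)"
      by (rule order_trans[OF le]) (intro add_mono K0 less_imp_le elim)
    also have "\<dots> = ennreal (3 * \<eta>)"
      using \<eta>(1) by (simp flip: ennreal_plus)
    finally show ?case
      using \<eta>(2) by simp
  qed
qed simp

section \<open>Gradients and first-order optimality\<close>

lemma gradient_GDERIV:
  assumes "\<exists>D. GDERIV f x :> D"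
  shows "GDERIV f x :> gradient f x"
proof -
  have "D = D'" if "GDERIV f x :> D" "GDERIV f x :> D'" for D D'
    using has_derivative_unique[OF that[unfolded gderiv_def]]
    by (metis (no_types) inner_commute vector_eq_rdot)
  then show ?thesis
    unfolding gradient_def using assms by (metis (no_types, lifting) theI)
qed

text \<open>
  The value of the objective at the minimizer is at most its value at a point of the domain
  of \<open>f\<close>, so it is not infinite. This is what licenses real arithmetic with the values of \<open>f\<close>
  at the two minimizers.
\<close>

lemma minimizer_finite:
  assumes "proper_ereal f" and min: "\<And>y. y \<in> S \<Longrightarrow> f a + ereal (\<phi> a) \<le> f y + ereal (\<phi> y)"
    and S: "\<And>y. f y \<noteq> \<infinity> \<Longrightarrow> y \<in> S"
  shows "\<bar>f a\<bar> \<noteq> \<infinity>"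
proof -
  obtain x where x: "f x \<noteq> \<infinity>" and ninf: "\<And>x. f x \<noteq> -\<infinity>"
    using assms(1) by (auto simp: proper_ereal_def)
  show ?thesis
    using min[OF S[OF x]] x ninf[of a] ninf[of x] by (cases "f a"; cases "f x") auto
qed

text \<open>
  Move from the minimizer \<open>a\<close> a fraction \<open>t\<close> of the way towards \<open>w\<close>. By convexity \<open>f\<close> drops by
  at least \<open>t * (p - q)\<close>, so by minimality \<open>\<phi>\<close> must rise by at least as much; divide by
  \<open>t\<close> and let it tend to zero. Only small \<open>t\<close> matter, so local minimality at \<open>a\<close>
  yields an inequality at every \<open>w\<close>, inside \<open>S\<close> or not.
\<close>

lemma first_order_optimality:
  fixes f :: "'a::euclidean_space \<Rightarrow> ereal" and \<phi> :: "'a \<Rightarrow> real"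
  assumes conv: "convex_ereal f" and S: "open S" "a \<in> S" and D: "GDERIV \<phi> a :> D"
    and min: "\<And>y. y \<in> S \<Longrightarrow> f a + ereal (\<phi> a) \<le> f y + ereal (\<phi> y)"
    and fin: "f a = ereal p" "f w = ereal q"
  shows "p - q \<le> (w - a) \<bullet> D"
proof -
  define \<psi> where "\<psi> t = \<phi> (a + t *\<^sub>R (w - a))" for t :: real
  have "(\<psi> has_derivative (\<lambda>t. (t *\<^sub>R (w - a)) \<bullet> D)) (at 0)"
    unfolding \<psi>_def
    by (rule has_derivative_compose[where f = "\<lambda>t. a + t *\<^sub>R (w - a)" and g = \<phi>])
      (use D[unfolded gderiv_def] in \<open>auto intro!: derivative_eq_intros\<close>)
  then have "DERIV \<psi> 0 :> (w - a) \<bullet> D"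
    unfolding has_field_derivative_def by (rule has_derivative_subst) (simp add: fun_eq_iff)
  then have "((\<lambda>t. (\<psi> t - \<psi> 0) / (t - 0)) \<longlongrightarrow> (w - a) \<bullet> D) (at 0)"
    by (simp add: has_field_derivative_iff)
  then have lim: "((\<lambda>t. (\<psi> t - \<psi> 0) / t) \<longlongrightarrow> (w - a) \<bullet> D) (at_right 0)"
    by (simp add: filterlim_at_split)
  have "((\<lambda>t. a + t *\<^sub>R (w - a)) \<longlongrightarrow> a + 0 *\<^sub>R (w - a)) (at_right 0)"
    by (intro tendsto_intros)
  then have "eventually (\<lambda>t. a + t *\<^sub>R (w - a) \<in> S) (at_right 0)"
    using S by (auto dest: topological_tendstoD)
  moreover have "eventually (\<lambda>t. t \<in> {0<..<1::real}) (at_right 0)"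
    by (rule eventually_at_right_real) simp
  ultimately have "eventually (\<lambda>t. p - q \<le> (\<psi> t - \<psi> 0) / t) (at_right 0)"
  proof (eventually_elim)
    case (elim t)
    have eq: "a + t *\<^sub>R (w - a) = (1 - t) *\<^sub>R a + t *\<^sub>R w"
      by (simp add: algebra_simps)
    have "ereal (p + \<psi> 0) \<le> f (a + t *\<^sub>R (w - a)) + ereal (\<psi> t)"
      using min[OF elim(1)] fin by (simp add: \<psi>_def)
    also have "\<dots> \<le> ereal (1 - t) * f a + ereal t * f w + ereal (\<psi> t)"
      using conv elim(2) unfolding convex_ereal_def eq by (intro add_right_mono) auto
    also have "\<dots> = ereal ((1 - t) * p + t * q + \<psi> t)"
      by (simp add: fin)
    finally have "t * (p - q) \<le> \<psi> t - \<psi> 0"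
      by (simp add: algebra_simps)
    then show ?case
      using elim(2) by (simp add: field_simps)
  qed
  then show ?thesis
    by (rule tendsto_lowerbound[OF lim]) simp
qed

section \<open>Positive definite matrices\<close>

lemma norm_matrix_vector_mult_le: "norm (A *v x) \<le> norm A * norm x" for A :: "real^'n^'m"
proof -
  have "norm (A *v x) = L2_set (\<lambda>i. \<bar>A $ i \<bullet> x\<bar>) UNIV"
    by (simp add: norm_vec_def matrix_vector_mul_component)
  also have "\<dots> \<le> L2_set (\<lambda>i. norm (A $ i) * norm x) UNIV"
    by (intro L2_set_mono Cauchy_Schwarz_ineq2) auto
  also have "\<dots> = norm A * norm x"
    by (simp add: norm_vec_def[of A] L2_set_left_distrib)
  finally show ?thesis .
qed

lemma pos_def_symmetric:
  assumes "pos_def A"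
  shows "x \<bullet> (A *v y) = (A *v x) \<bullet> y"
  using assms by (metis dot_lmul_matrix pos_def_def vector_transpose_matrix)

text \<open>The constant is the minimum of the quadratic form over the compact unit sphere.\<close>

lemma pos_def_coercive:
  assumes "pos_def (A :: real^'d^'d)"
  obtains l where "l > 0" "\<And>x. l * (norm x)\<^sup>2 \<le> x \<bullet> (A *v x)"
proof -
  have "continuous_on (sphere 0 1) (\<lambda>x::real^'d. x \<bullet> (A *v x))"
    by (intro continuous_intros linear_continuous_on) auto
  moreover have "sphere (0 :: real^'d) 1 \<noteq> {}"
    by simp
  ultimately obtain u :: "real^'d" where u: "u \<in> sphere 0 1"
    and umin: "\<And>x. x \<in> sphere 0 1 \<Longrightarrow> u \<bullet> (A *v u) \<le> x \<bullet> (A *v x)"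
    using continuous_attains_inf[OF compact_sphere, of 0 1 "\<lambda>x. x \<bullet> (A *v x)"] by blast
  have "u \<noteq> 0"
    using u by auto
  have "u \<bullet> (A *v u) * (norm x)\<^sup>2 \<le> x \<bullet> (A *v x)" for x
  proof (cases "x = 0")
    case False
    have "u \<bullet> (A *v u) \<le> sgn x \<bullet> (A *v sgn x)"
      using False by (intro umin) (simp add: norm_sgn)
    also have "\<dots> = x \<bullet> (A *v x) / (norm x)\<^sup>2"
      by (simp add: sgn_div_norm matrix_vector_mult_scaleR power2_eq_square divide_simps)
    finally show ?thesis
      using False by (simp add: field_simps)
  qed simp
  then show thesis
    using that assms \<open>u \<noteq> 0\<close> by (auto simp: pos_def_def)
qed

lemma pos_def_matrix_inv:
  assumes "pos_def (A :: real^'d^'d)"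
  shows "A ** matrix_inv A = mat 1"
proof -
  have "A *v x = 0 \<Longrightarrow> x = 0" for x
    using assms by (metis inner_zero_right less_irrefl pos_def_def)
  then have "invertible A"
    by (metis invertible_left_inverse matrix_left_invertible_ker)
  then show ?thesis
    unfolding invertible_def matrix_inv_def by (rule someI2_ex) simp
qed

lemma GDERIV_half_scaled_norm_sq:
  assumes "pos_def A"
  shows "GDERIV (\<lambda>w. 1/2 * scaled_norm_sq A (w - x)) c :> A *v (c - x)"
proof -
  have "((\<lambda>w. 1/2 * ((w - x) \<bullet> (A *v (w - x)))) has_derivative
      (\<lambda>h. 1/2 * ((c - x) \<bullet> (A *v h) + h \<bullet> (A *v (c - x))))) (at c)"
    by (auto intro!: derivative_eq_intros bounded_linear.has_derivative[OF matrix_vector_mul_bounded_linear])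
  moreover have "1/2 * ((c - x) \<bullet> (A *v h) + h \<bullet> (A *v (c - x))) = h \<bullet> (A *v (c - x))" for h
    by (simp add: pos_def_symmetric[OF assms] inner_commute)
  ultimately show ?thesis
    unfolding gderiv_def scaled_norm_sq_def by simp
qed

text \<open>
  With \<open>E = C\<^sup>-\<^sup>1H - I\<close> one has \<open>H - C = C E\<close>, so it remains to bound \<open>C\<close> itself. Since
  \<open>C = H - C E\<close>, its operator norm \<open>k\<close> satisfies \<open>k \<le> norm H + k / 2\<close>, which gives
  \<open>k \<le> 2 * norm H\<close>.
\<close>

lemma norm_diff_le_preconditioner_error:
  fixes C H :: "real^'d^'d"
  assumes "pos_def C" and e: "norm (matrix_inv C ** H - mat 1) \<le> 1/2"
  shows "norm ((H - C) *v x) \<le> 2 * norm H * norm (matrix_inv C ** H - mat 1) * norm x"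
proof -
  define E where "E = matrix_inv C ** H - mat 1"
  have H: "H = C ** (mat 1 + E)"
    by (simp add: E_def matrix_mul_assoc pos_def_matrix_inv[OF assms(1)])
  have HC: "(H - C) *v x = C *v (E *v x)" for x
    by (subst H) (simp add: matrix_add_ldistrib matrix_vector_mul_assoc)
  let ?k = "onorm ((*v) C)"
  have k0: "?k \<ge> 0" by (intro onorm_pos_le) auto
  have C: "norm (C *v y) \<le> ?k * norm y" for y
    by (intro onorm) auto
  have E: "norm (C *v (E *v x)) \<le> ?k * norm E * norm x" for x
  proof -
    have "norm (C *v (E *v x)) \<le> ?k * norm (E *v x)"
      by (rule C)
    also have "\<dots> \<le> ?k * (norm E * norm x)"
      by (intro mult_left_mono norm_matrix_vector_mult_le k0)
    finally show ?thesis by (simp add: mult.assoc)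
  qed
  have "?k \<le> norm H + ?k * norm E"
  proof (rule onorm_le)
    fix x
    have "C *v x = H *v x - C *v (E *v x)"
      by (simp flip: HC add: matrix_vector_mult_diff_rdistrib)
    then have "norm (C *v x) \<le> norm (H *v x) + norm (C *v (E *v x))"
      by (simp add: norm_triangle_ineq4)
    also have "\<dots> \<le> norm H * norm x + ?k * norm E * norm x"
      by (intro add_mono E norm_matrix_vector_mult_le)
    finally show "norm (C *v x) \<le> (norm H + ?k * norm E) * norm x"
      by (simp add: algebra_simps)
  qed
  also have "?k * norm E \<le> ?k * (1/2)"
    using e k0 by (intro mult_left_mono) (auto simp: E_def)
  finally have k: "?k \<le> 2 * norm H"
    by simp
  have "norm ((H - C) *v x) \<le> ?k * norm E * norm x"
    unfolding HC by (rule E)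
  also have "\<dots> \<le> 2 * norm H * norm E * norm x"
    by (intro mult_right_mono k) auto
  finally show ?thesis by (simp add: E_def)
qed

section \<open>The error of one proximal step\<close>

text \<open>
  Adding the variational inequality of \<open>a\<close> at \<open>c\<close> and that of \<open>c\<close> at \<open>a\<close> eliminates \<open>h\<close>.
  The quadratic form in \<open>H\<close> rather than in \<open>C\<close> is kept on the left, so that the
  coercivity constant \<open>l\<close> does not depend on \<open>C\<close>; the resulting error term
  \<open>v \<bullet> (H - C) v\<close> is absorbed by half of \<open>l * (norm v)\<^sup>2\<close>, which is what the bound on
  \<open>4 * norm H\<close> times the preconditioner error is for.
\<close>

lemma one_step_error:
  fixes C H :: "real^'d^'d" and h :: "real^'d \<Rightarrow> ereal"
  assumes S: "open S"
    and diff: "\<And>x. x \<in> S \<Longrightarrow> \<exists>D. GDERIV g x :> D"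
    and h: "convex_ereal (extend_infty S h)" "proper_ereal (extend_infty S h)"
    and a: "is_arg_min (\<lambda>x. ereal (g x) + h x) (\<lambda>x. x \<in> S) a"
    and C: "pos_def C"
    and c: "c \<in> prox C (extend_infty S h) (b - matrix_inv C *v gradient g b)"
    and l: "l > 0" "\<And>x. l * (norm x)\<^sup>2 \<le> x \<bullet> (H *v x)"
    and small: "norm (matrix_inv C ** H - mat 1) \<le> 1/2"
      "4 * norm H * norm (matrix_inv C ** H - mat 1) \<le> l"
  shows "norm (c - a) \<le> 2 / l * (2 * norm H * norm (matrix_inv C ** H - mat 1) * norm (b - a)
           + norm (gradient g b - gradient g a - H *v (b - a)))"
proof -
  define f where "f = extend_infty S h"
  define e where "e = norm (matrix_inv C ** H - mat 1)"
  define v where "v = c - a"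
  define r where "r = gradient g b - gradient g a - H *v (b - a)"
  define x where "x = b - matrix_inv C *v gradient g b"
  have aS: "a \<in> S"
    using a by (simp add: is_arg_min_def)
  have mina: "f a + ereal (g a) \<le> f y + ereal (g y)" if "y \<in> S" for y
    using a aS that by (auto simp: is_arg_min_def f_def extend_infty_def not_less add.commute)
  have minc: "f c + ereal (1/2 * scaled_norm_sq C (c - x)) \<le> f y + ereal (1/2 * scaled_norm_sq C (y - x))" for y
    using c by (auto simp: prox_def is_arg_min_def f_def x_def not_less)
  have "\<bar>f a\<bar> \<noteq> \<infinity>"
    by (rule minimizer_finite[where \<phi> = g, OF h(2)[folded f_def] mina])
      (auto simp: f_def extend_infty_def split: if_splits)
  then obtain p where p: "f a = ereal p" by auto
  have "\<bar>f c\<bar> \<noteq> \<infinity>"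
    using h(2) minc
    by (intro minimizer_finite[where S = UNIV and \<phi> = "\<lambda>y. 1/2 * scaled_norm_sq C (y - x)"]) (auto simp: f_def)
  then obtain q where q: "f c = ereal q" by auto
  have conv: "convex_ereal f"
    using h(1) by (simp add: f_def)
  have "p - q \<le> (c - a) \<bullet> gradient g a"
    by (rule first_order_optimality[OF conv S aS gradient_GDERIV[OF diff[OF aS]] mina p q])
  moreover have "q - p \<le> (a - c) \<bullet> (C *v (c - x))"
    by (rule first_order_optimality[OF conv open_UNIV UNIV_I GDERIV_half_scaled_norm_sq[OF C] minc q p])
  ultimately have "v \<bullet> (C *v (c - x)) \<le> v \<bullet> gradient g a"
    by (simp add: v_def inner_diff_left)
  also have "C *v (c - x) = C *v v - C *v (b - a) + gradient g b"
    by (simp add: x_def v_def algebra_simps matrix_vector_mult_diff_distrib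
        matrix_vector_right_distrib matrix_vector_mul_assoc pos_def_matrix_inv[OF C])
  (* Add v \<bullet> (H - C) v to both sides. *)
  finally have "v \<bullet> (H *v v) \<le> v \<bullet> ((H - C) *v v) - v \<bullet> ((H - C) *v (b - a)) - v \<bullet> r"
    by (simp add: r_def inner_diff_right inner_add_right matrix_vector_mult_diff_rdistrib)
  also have "\<dots> \<le> norm v * (2 * norm H * e * norm v) + norm v * (2 * norm H * e * norm (b - a)) + norm v * norm r"
  proof -
    have CH: "norm ((H - C) *v y) \<le> 2 * norm H * e * norm y" for y
      unfolding e_def by (rule norm_diff_le_preconditioner_error[OF C small(1)])
    have "\<bar>v \<bullet> ((H - C) *v y)\<bar> \<le> norm v * (2 * norm H * e * norm y)" for y
      by (rule order_trans[OF Cauchy_Schwarz_ineq2 mult_left_mono[OF CH]]) simp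
    from this[of v] this[of "b - a"] Cauchy_Schwarz_ineq2[of v r] show ?thesis
      by linarith
  qed
  also have "\<dots> = norm v * (2 * norm H * e * norm v + 2 * norm H * e * norm (b - a) + norm r)"
    by (simp add: algebra_simps)
  finally have "norm v * (l * norm v) \<le> norm v * (2 * norm H * e * norm v + 2 * norm H * e * norm (b - a) + norm r)"
    using l(2)[of v] by (simp add: power2_eq_square mult.left_commute)
  then have "v = 0 \<or> l * norm v \<le> 2 * norm H * e * norm v + 2 * norm H * e * norm (b - a) + norm r"
    unfolding mult_le_cancel_left by auto
  moreover have "2 * norm H * e * norm v \<le> l / 2 * norm v"
    using small(2) by (intro mult_right_mono) (auto simp: e_def)
  moreover have "0 \<le> 2 * norm H * e * norm (b - a) + norm r"
    by (simp add: e_def)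
  ultimately have "l / 2 * norm v \<le> 2 * norm H * e * norm (b - a) + norm r"
    by (elim disjE) (simp, linarith)
  then show ?thesis
    using l(1) unfolding v_def r_def e_def by (simp add: field_simps)
qed

theorem theorem2p1:
  fixes M :: "'w measure"
    and \<Theta> :: "(real^'d) set"
    and g :: "nat \<Rightarrow> 'w \<Rightarrow> real^'d \<Rightarrow> real"
    and h :: "nat \<Rightarrow> 'w \<Rightarrow> real^'d \<Rightarrow> ereal"
    and C :: "nat \<Rightarrow> 'w \<Rightarrow> real^'d^'d"
    and H :: "real^'d^'d"
    and \<theta>_hat \<theta>_init \<theta>_ose :: "nat \<Rightarrow> 'w \<Rightarrow> real^'d"
  assumes "prob_space M"
    and "open \<Theta>"
    and g_random: "\<And>n \<theta>. \<theta> \<in> \<Theta> \<Longrightarrow> (\<lambda>\<omega>. g n \<omega> \<theta>) \<in> borel_measurable M"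
    and h_random: "\<And>n \<theta>. \<theta> \<in> \<Theta> \<Longrightarrow> (\<lambda>\<omega>. h n \<omega> \<theta>) \<in> borel_measurable M"
    and h_range: "\<And>n \<omega> \<theta>. \<omega> \<in> space M \<Longrightarrow> \<theta> \<in> \<Theta> \<Longrightarrow> h n \<omega> \<theta> \<noteq> -\<infinity>"
    and C_random: "\<And>n. C n \<in> borel_measurable M"
    and gh: "AE \<omega> in M. \<forall>n. continuously_differentiable_on (g n \<omega>) \<Theta> \<and>
               convex_ereal (extend_infty \<Theta> (h n \<omega>)) \<and> proper_ereal (extend_infty \<Theta> (h n \<omega>))"
    and hat_est: "estimator M \<Theta> \<theta>_hat"
    and hat: "AE \<omega> in M. \<forall>n.
               is_arg_min (\<lambda>\<theta>. ereal (g n \<omega> \<theta>) + h n \<omega> \<theta>) (\<lambda>\<theta>. \<theta> \<in> \<Theta>) (\<theta>_hat n \<omega>)"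
    and H: "pos_def H"
    and i: "\<And>K::real. K > 0 \<Longrightarrow>
             vanishes_in_prob M (\<lambda>n \<omega>.
               SUP \<theta> \<in> {\<theta> \<in> \<Theta>. sqrt (real n) * norm (\<theta> - \<theta>_hat n \<omega>) < K}.
                 ennreal (norm (sqrt (real n) *\<^sub>R (gradient (g n \<omega>) \<theta> - gradient (g n \<omega>) (\<theta>_hat n \<omega>))
                                - sqrt (real n) *\<^sub>R (H *v (\<theta> - \<theta>_hat n \<omega>)))))"
    and ii_pd: "AE \<omega> in M. \<forall>n. pos_def (C n \<omega>)"
    and ii_lim: "tendsto_in_prob M (\<lambda>n \<omega>. matrix_inv (C n \<omega>) ** H) (mat 1)"
    and init_est: "estimator M \<Theta> \<theta>_init"
    and init: "sqrt_n_consistent M \<theta>_init \<theta>_hat"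
    and ose_est: "estimator M \<Theta> \<theta>_ose"
    and ose: "AE \<omega> in M. \<forall>n. \<theta>_ose n \<omega> \<in>
               prox (C n \<omega>) (extend_infty \<Theta> (h n \<omega>))
                 (\<theta>_init n \<omega> - matrix_inv (C n \<omega>) *v gradient (g n \<omega>) (\<theta>_init n \<omega>))"
  shows "asymptotically_equivalent M \<theta>_hat \<theta>_ose"
proof -
  obtain l where l: "l > 0" "\<And>x. l * (norm x)\<^sup>2 \<le> x \<bullet> (H *v x)"
    using pos_def_coercive[OF H] by blast
  let ?r = "\<lambda>n \<omega> \<theta>. sqrt (real n) *\<^sub>R (gradient (g n \<omega>) \<theta> - gradient (g n \<omega>) (\<theta>_hat n \<omega>))
                      - sqrt (real n) *\<^sub>R (H *v (\<theta> - \<theta>_hat n \<omega>))"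
  have "vanishes_in_prob M (\<lambda>n \<omega>. ennreal (sqrt (real n) * norm (\<theta>_hat n \<omega> - \<theta>_ose n \<omega>)))"
  proof (rule vanishes_in_prob_if_small_on_bounded[OF init[unfolded sqrt_n_consistent_def] i
        ii_lim[unfolded tendsto_in_prob_def]])
    fix K \<epsilon> :: real
    assume "K > 0" "\<epsilon> > 0"
    (* The first two bounds meet the smallness conditions of one_step_error; the third makes its bound,
       scaled by sqrt n, at most \<epsilon>. Adding 1 to the denominators keeps them positive. *)
    define \<rho> where "\<rho> = Min {1/2, l / (4 * (norm H + 1)), l * \<epsilon> / (2 * (2 * norm H * K + 1))}"
    have den: "0 < norm H + 1" "0 < 2 * norm H * K + 1"
      using \<open>K > 0\<close> by (auto intro: add_nonneg_pos)
    have "\<rho> > 0"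
      using l(1) \<open>\<epsilon> > 0\<close> den by (simp add: \<rho>_def)
    have \<rho>1: "\<rho> \<le> 1/2" unfolding \<rho>_def by (rule Min_le) auto
    have "\<rho> \<le> l / (4 * (norm H + 1))" by (simp add: \<rho>_def)
    then have "\<rho> * (4 * (norm H + 1)) \<le> l"
      using den by (simp add: pos_le_divide_eq)
    then have \<rho>2: "4 * norm H * \<rho> \<le> l"
      using \<open>\<rho> > 0\<close> by (simp add: algebra_simps)
    have "\<rho> \<le> l * \<epsilon> / (2 * (2 * norm H * K + 1))" by (simp add: \<rho>_def)
    then have "\<rho> * (2 * (2 * norm H * K + 1)) \<le> l * \<epsilon>"
      using den by (simp add: pos_le_divide_eq)
    then have \<rho>3: "2 / l * (2 * norm H * \<rho> * K + \<rho>) \<le> \<epsilon>"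
      using l(1) by (simp add: field_simps)
    have init_in: "AE \<omega> in M. \<forall>n. \<theta>_init n \<omega> \<in> \<Theta>"
      using init_est by (simp add: estimator_def AE_all_countable)
    have "AE \<omega> in M. \<forall>n. norm (sqrt (real n) *\<^sub>R (\<theta>_init n \<omega> - \<theta>_hat n \<omega>)) < K \<longrightarrow>
        (SUP \<theta> \<in> {\<theta> \<in> \<Theta>. sqrt (real n) * norm (\<theta> - \<theta>_hat n \<omega>) < K}. ennreal (norm (?r n \<omega> \<theta>))) \<le> ennreal \<rho> \<longrightarrow>
        ennreal (dist (matrix_inv (C n \<omega>) ** H) (mat 1)) \<le> ennreal \<rho> \<longrightarrow>
        ennreal (sqrt (real n) * norm (\<theta>_hat n \<omega> - \<theta>_ose n \<omega>)) \<le> ennreal \<epsilon>"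
      using gh hat ii_pd ose init_in
    proof (eventually_elim, intro allI impI)
      fix \<omega> n
      assume gh: "\<forall>n. continuously_differentiable_on (g n \<omega>) \<Theta> \<and>
               convex_ereal (extend_infty \<Theta> (h n \<omega>)) \<and> proper_ereal (extend_infty \<Theta> (h n \<omega>))"
        and hat: "\<forall>n. is_arg_min (\<lambda>\<theta>. ereal (g n \<omega> \<theta>) + h n \<omega> \<theta>) (\<lambda>\<theta>. \<theta> \<in> \<Theta>) (\<theta>_hat n \<omega>)"
        and pd: "\<forall>n. pos_def (C n \<omega>)"
        and ose: "\<forall>n. \<theta>_ose n \<omega> \<in> prox (C n \<omega>) (extend_infty \<Theta> (h n \<omega>))
                 (\<theta>_init n \<omega> - matrix_inv (C n \<omega>) *v gradient (g n \<omega>) (\<theta>_init n \<omega>))"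
        and init_in: "\<forall>n. \<theta>_init n \<omega> \<in> \<Theta>"
        and near: "norm (sqrt (real n) *\<^sub>R (\<theta>_init n \<omega> - \<theta>_hat n \<omega>)) < K"
        and sup: "(SUP \<theta> \<in> {\<theta> \<in> \<Theta>. sqrt (real n) * norm (\<theta> - \<theta>_hat n \<omega>) < K}.
                    ennreal (norm (?r n \<omega> \<theta>))) \<le> ennreal \<rho>"
        and dist: "ennreal (dist (matrix_inv (C n \<omega>) ** H) (mat 1)) \<le> ennreal \<rho>"
      define s where "s = sqrt (real n)"
      define e where "e = norm (matrix_inv (C n \<omega>) ** H - mat 1)"
      define r where "r = gradient (g n \<omega>) (\<theta>_init n \<omega>) - gradient (g n \<omega>) (\<theta>_hat n \<omega>)
                            - H *v (\<theta>_init n \<omega> - \<theta>_hat n \<omega>)"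
      have s: "s \<ge> 0" by (simp add: s_def)
      have near': "s * norm (\<theta>_init n \<omega> - \<theta>_hat n \<omega>) < K"
        using near by (simp add: s_def)
      have "ennreal (norm (?r n \<omega> (\<theta>_init n \<omega>))) \<le> ennreal \<rho>"
        using near' init_in by (intro order_trans[OF SUP_upper sup]) (simp add: s_def)
      moreover have "?r n \<omega> (\<theta>_init n \<omega>) = s *\<^sub>R r"
        by (simp add: r_def s_def scaleR_diff_right)
      ultimately have r: "s * norm r \<le> \<rho>"
        using \<open>\<rho> > 0\<close> s by simp
      have e0: "0 \<le> e" by (simp add: e_def)
      have e: "e \<le> \<rho>"
        using dist \<open>\<rho> > 0\<close> by (simp add: e_def dist_norm)
      have "4 * norm H * e \<le> 4 * norm H * \<rho>"
        using e by (intro mult_left_mono) auto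
      then have "norm (\<theta>_ose n \<omega> - \<theta>_hat n \<omega>)
          \<le> 2 / l * (2 * norm H * e * norm (\<theta>_init n \<omega> - \<theta>_hat n \<omega>) + norm r)"
        using gh hat pd ose l e \<rho>1 \<rho>2 \<open>open \<Theta>\<close> unfolding e_def r_def
        by (intro one_step_error) (auto simp: continuously_differentiable_on_def)
      then have "s * norm (\<theta>_ose n \<omega> - \<theta>_hat n \<omega>)
          \<le> s * (2 / l * (2 * norm H * e * norm (\<theta>_init n \<omega> - \<theta>_hat n \<omega>) + norm r))"
        using s by (rule mult_left_mono)
      also have "\<dots> = 2 / l * (2 * norm H * e * (s * norm (\<theta>_init n \<omega> - \<theta>_hat n \<omega>)) + s * norm r)"
        by (simp add: algebra_simps)
      also have "\<dots> \<le> 2 / l * (2 * norm H * \<rho> * K + \<rho>)"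
        using l(1) near' r e e0 s \<open>\<rho> > 0\<close> by (intro mult_left_mono add_mono mult_mono) auto
      also have "\<dots> \<le> \<epsilon>" by (rule \<rho>3)
      finally show "ennreal (sqrt (real n) * norm (\<theta>_hat n \<omega> - \<theta>_ose n \<omega>)) \<le> ennreal \<epsilon>"
        by (simp add: s_def norm_minus_commute ennreal_leI)
    qed
    then show "\<exists>\<rho>>0. AE \<omega> in M. \<forall>n. norm (sqrt (real n) *\<^sub>R (\<theta>_init n \<omega> - \<theta>_hat n \<omega>)) < K \<longrightarrow>
        (SUP \<theta> \<in> {\<theta> \<in> \<Theta>. sqrt (real n) * norm (\<theta> - \<theta>_hat n \<omega>) < K}. ennreal (norm (?r n \<omega> \<theta>))) \<le> ennreal \<rho> \<longrightarrow>
        ennreal (dist (matrix_inv (C n \<omega>) ** H) (mat 1)) \<le> ennreal \<rho> \<longrightarrow>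
        ennreal (sqrt (real n) * norm (\<theta>_hat n \<omega> - \<theta>_ose n \<omega>)) \<le> ennreal \<epsilon>"
      using \<open>\<rho> > 0\<close> by blast
  qed
  then show ?thesis
    by (simp add: asymptotically_equivalent_def tendsto_in_prob_def)
qed

end
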